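(* Let $N\ge 1$, let $a_1<a_2<\dots<a_N$ be positive integers with $\gcd(a_1,\dots,a_N)=1$, let $S=\langle a_1,\dots,a_N\rangle$ be the numerical semigroup they generate, and let $w_1,\dots,w_N$ be strictly positive real numbers. Let $g_k$ denote the coefficient of $z^k$ in the power series expansion $\frac{1}{1-w_1z^{a_1}-\dots-w_Nz^{a_N}}=\sum_{k=0}^{+\infty}g_kz^k$. Then, for every $k\in\mathbb{N}\cup\{0\}$, $g_k=0$ if and only if $k\notin S$.
   Context: $\mathbb{N}$ denotes the positive integers. The numerical semigroup generated by $a_1,\dots,a_N$ is $S=\langle a_1,\dots,a_N\rangle=\{\sum_{i=1}^N n_ia_i : n_i\in\mathbb{N}\cup\{0\}\}$; the $a_i$ are not required to be a minimal set of generators. The power series expansion is the one at $z=0$ (equivalently, the formal power series inverse of $1-\sum_{i=1}^N w_iz^{a_i}$). *)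

theory Defs
  imports "HOL-Computational_Algebra.Formal_Power_Series"
begin

definition semigroup_generated :: "nat \<Rightarrow> (nat \<Rightarrow> nat) \<Rightarrow> nat set" where
  "semigroup_generated N a = {(\<Sum>i=1..N. n i * a i) | n :: nat \<Rightarrow> nat. True}"

(* The division is that of real formal power series; since all a i are positive, the
   denominator has constant term 1, so this is the genuine multiplicative inverse. *)
definition generating_series :: "nat \<Rightarrow> (nat \<Rightarrow> nat) \<Rightarrow> (nat \<Rightarrow> real) \<Rightarrow> real fps" where
  "generating_series N a w = 1 / (1 - (\<Sum>i=1..N. fps_const (w i) * fps_X ^ a i))"

end

theory Submission
  imports Defs
begin

text \<open>
  Write \<open>F = 1 / (1 - P)\<close> with \<open>P = \<Sum> w\<^sub>i X\<^bsup>a\<^sub>i\<^esup>\<close>. Comparing coefficients in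
  \<open>F = 1 + P F\<close> gives \<open>g\<^sub>0 = 1\<close> and, for \<open>k > 0\<close>, the recurrence
  \<open>g\<^sub>k = \<Sum> w\<^sub>i g\<^bsub>k - a\<^sub>i\<^esub>\<close>, the sum ranging over the \<open>i\<close> with \<open>a\<^sub>i \<le> k\<close>. The semigroup
  \<open>S\<close> satisfies the parallel recursion: \<open>0 \<in> S\<close>, and \<open>k > 0\<close> lies in \<open>S\<close> iff
  \<open>k - a\<^sub>i \<in> S\<close> for some \<open>i\<close> with \<open>a\<^sub>i \<le> k\<close>. Since the weights are positive, no
  cancellation occurs, so strong induction on \<open>k\<close> shows that \<open>g\<^sub>k\<close> is positive on \<open>S\<close>
  and zero elsewhere.
\<close>

lemma zero_in_semigroup_generated: "0 \<in> semigroup_generated N a"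
  unfolding semigroup_generated_def by (auto intro!: exI[of _ "\<lambda>_. 0"])

lemma add_generator_in_semigroup_generated:
  assumes "s \<in> semigroup_generated N a" and i: "i \<in> {1..N}"
  shows "a i + s \<in> semigroup_generated N a"
proof -
  obtain n where s: "s = (\<Sum>j=1..N. n j * a j)"
    using assms(1) unfolding semigroup_generated_def by blast
  have "(\<Sum>j=1..N. (n(i := Suc (n i))) j * a j)
      = (\<Sum>j=1..N. (if j = i then a j else 0) + n j * a j)"
    by (rule sum.cong) auto
  also have "\<dots> = a i + s"
    using i by (simp add: sum.distrib s)
  finally show ?thesis
    unfolding semigroup_generated_def by (intro CollectI exI[of _ "n(i := Suc (n i))"]) simp
qed

lemma semigroup_generated_remove_generator:
  assumes "k \<in> semigroup_generated N a" and "k > 0"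
  obtains i where "i \<in> {1..N}" and "a i \<le> k" and "k - a i \<in> semigroup_generated N a"
proof -
  obtain n where k: "k = (\<Sum>j=1..N. n j * a j)"
    using assms(1) unfolding semigroup_generated_def by blast
  have "(\<Sum>j=1..N. n j * a j) \<noteq> 0"
    using \<open>k > 0\<close> unfolding k by linarith
  then obtain i where i: "i \<in> {1..N}" "n i * a i \<noteq> 0"
    by (rule sum.not_neutral_contains_not_neutral)
  let ?m = "n(i := n i - 1)"
  have "k = (\<Sum>j=1..N. (if j = i then a j else 0) + ?m j * a j)"
    unfolding k using i(2) by (intro sum.cong) (cases "n i"; auto)+
  also have "\<dots> = a i + (\<Sum>j=1..N. ?m j * a j)"
    using i by (simp add: sum.distrib)
  finally have "k = a i + (\<Sum>j=1..N. ?m j * a j)" .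
  moreover have "(\<Sum>j=1..N. ?m j * a j) \<in> semigroup_generated N a"
    unfolding semigroup_generated_def by blast
  ultimately show thesis
    using that[of i] i(1) by simp
qed

lemma generating_series_fixed_point:
  assumes pos: "\<And>i. i \<in> {1..N} \<Longrightarrow> a i > 0"
  shows "generating_series N a w
    = 1 + (\<Sum>i=1..N. fps_const (w i) * fps_X ^ a i) * generating_series N a w"
proof -
  let ?P = "\<Sum>i=1..N. fps_const (w i) * fps_X ^ a i"
  have P0: "fps_nth ?P 0 = 0"
    unfolding fps_sum_nth using pos by (intro sum.neutral) (simp add: less_imp_neq)
  then have "(1 - ?P) * inverse (1 - ?P) = 1"
    by (intro inverse_mult_eq_1') simp
  moreover have "generating_series N a w = inverse (1 - ?P)"
    using P0 unfolding generating_series_def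
    by (simp add: fps_divide_unit)
  ultimately show ?thesis
    by (simp add: algebra_simps)
qed

lemma generating_series_nth_rec:
  assumes "\<And>i. i \<in> {1..N} \<Longrightarrow> a i > 0"
  shows "fps_nth (generating_series N a w) k = (if k = 0 then 1 else 0)
    + (\<Sum>i=1..N. if a i \<le> k then w i * fps_nth (generating_series N a w) (k - a i) else 0)"
proof -
  have "fps_nth (generating_series N a w) k = fps_nth
     (1 + (\<Sum>i=1..N. fps_const (w i) * fps_X ^ a i) * generating_series N a w) k"
    by (rule arg_cong[where f = "\<lambda>F. fps_nth F k"], rule generating_series_fixed_point)
      (rule assms)
  also have "\<dots> = (if k = 0 then 1 else 0)
    + (\<Sum>i=1..N. if a i \<le> k then w i * fps_nth (generating_series N a w) (k - a i) else 0)"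
    by (auto simp: sum_distrib_right fps_sum_nth mult.assoc fps_X_power_mult_nth
        intro!: sum.cong)
  finally show ?thesis .
qed

text \<open>
  Merely \<open>g\<^sub>k \<noteq> 0\<close> on \<open>S\<close> would be too weak an induction hypothesis: it is the positivity
  of the earlier coefficients that excludes cancellation in the recurrence.
\<close>
lemma generating_series_nth_sign:
  assumes a_pos: "\<And>i. i \<in> {1..N} \<Longrightarrow> a i > 0"
    and w_pos: "\<And>i. i \<in> {1..N} \<Longrightarrow> w i > 0"
  shows "(k \<in> semigroup_generated N a \<longrightarrow> fps_nth (generating_series N a w) k > 0) \<and>
    (k \<notin> semigroup_generated N a \<longrightarrow> fps_nth (generating_series N a w) k = 0)"
proof (induction k rule: less_induct)
  case (less k)
  let ?S = "semigroup_generated N a" and ?g = "fps_nth (generating_series N a w)"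
  let ?t = "\<lambda>i. if a i \<le> k then w i * ?g (k - a i) else 0"
  have rec: "?g k = (if k = 0 then 1 else 0) + (\<Sum>i=1..N. ?t i)"
    by (rule generating_series_nth_rec) (rule a_pos)
  have IH: "(k - a i \<in> ?S \<longrightarrow> ?g (k - a i) > 0) \<and> (k - a i \<notin> ?S \<longrightarrow> ?g (k - a i) = 0)"
    if "i \<in> {1..N}" "a i \<le> k" for i
    using less.IH[of "k - a i"] a_pos[OF that(1)] that(2) by simp
  have t_nonneg: "?t i \<ge> 0" if "i \<in> {1..N}" for i
    using IH[OF that] w_pos[OF that] by (cases "k - a i \<in> ?S") auto
  have sum_nonneg: "(\<Sum>i=1..N. ?t i) \<ge> 0"
    by (rule sum_nonneg) (rule t_nonneg)
  show ?case
  proof (intro conjI impI)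
    assume k: "k \<in> ?S"
    show "?g k > 0"
    proof (cases "k = 0")
      case True
      then show ?thesis using rec sum_nonneg by simp
    next
      case False
      then obtain i where i: "i \<in> {1..N}" "a i \<le> k" "k - a i \<in> ?S"
        using k semigroup_generated_remove_generator by blast
      then have "?t i > 0" using IH w_pos by simp
      then have "(\<Sum>i=1..N. ?t i) > 0"
        using i(1) t_nonneg by (intro sum_pos2[where i = i]) auto
      then show ?thesis using rec False by simp
    qed
  next
    assume k: "k \<notin> ?S"
    have "?t i = 0" if "i \<in> {1..N}" for i
    proof (cases "a i \<le> k")
      case True
      then have "k - a i \<notin> ?S"
        using add_generator_in_semigroup_generated[of "k - a i" N a i] that k by auto
      then show ?thesis using IH that True by simp
    qed simp
    then have "(\<Sum>i=1..N. ?t i) = 0" by (intro sum.neutral) blast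
    moreover have "k \<noteq> 0" using k zero_in_semigroup_generated by metis
    ultimately show "?g k = 0" using rec by simp
  qed
qed

theorem lemma2p2:
  fixes N :: nat and a :: "nat \<Rightarrow> nat" and w :: "nat \<Rightarrow> real" and k :: nat
  assumes "N \<ge> 1"
    and "\<And>i. i \<in> {1..N} \<Longrightarrow> a i > 0"
    and "strict_mono_on {1..N} a"
    and "Gcd (a ` {1..N}) = 1"
    and "\<And>i. i \<in> {1..N} \<Longrightarrow> w i > 0"
  shows "fps_nth (generating_series N a w) k = 0 \<longleftrightarrow> k \<notin> semigroup_generated N a"
  using generating_series_nth_sign[of N a w k, OF assms(2) assms(5)] by auto

end
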